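(* Let $0<q<1$, let $n\ge 0$ be an integer, and let $p(x)\in\mathbb{C}[x]$ be a polynomial of degree at most $n$, written as $p(x)=\sum_{k=0}^{n}b_{k,q}E_{k,q}(x)$ in terms of the $q$-Euler polynomials defined in the context. Then for $0\le k\le n$, $$b_{k,q}=\frac{1}{2[k]_q!}\left\langle \left( e_q(t)+1 \right) t^k \,\big\vert\, p(x)\right\rangle=\frac{1}{2[k]_q!} \left\{ p^{(k)}(1)+ p^{(k)}(0)\right\},$$ where $p^{(k)}(x)=D_q^kp(x)$.
   Context: Fix a real number $q$ with $0<q<1$. For an integer $n\ge 0$ set $[n]_q=\frac{1-q^n}{1-q}$, $[0]_q!=1$, $[n]_q!=[1]_q\cdots[n]_q$. Let $e_q(z)=\sum_{n=0}^{\infty}\frac{z^n}{[n]_q!}$. The $q$-Euler polynomials $E_{n,q}(x)$ are defined by the formal power series identity in $t$: $\frac{2}{e_q(t)+1}e_q(xt)=\sum_{n=0}^{\infty}E_{n,q}(x)\frac{t^n}{[n]_q!}$. The $q$-derivative is $D_qf(x)=\frac{f(x)-f(qx)}{(1-q)x}$ for $x\neq 0$ and $D_qf(0)=f'(0)$; on polynomials $D_qx^n=[n]_qx^{n-1}$. For a formal power series $f(t)=\sum_{k=0}^{\infty}\frac{a_k}{[k]_q!}t^k$ with complex coefficients, the linear functional $\langle f(t)\,|\,\cdot\,\rangle$ on $\mathbb{C}[x]$ is defined by $\langle f(t)\,|\,x^n\rangle=a_n$ for all $n\ge0$, extended linearly; products such as $(e_q(t)+1)t^k$ are products of formal power series.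 *)

theory Defs
  imports
    "HOL-Analysis.Derivative"
    "HOL-Computational_Algebra.Formal_Power_Series"
    "HOL-Computational_Algebra.Polynomial"
begin

definition q_bracket :: "real \<Rightarrow> nat \<Rightarrow> real" where
  "q_bracket q n = (1 - q ^ n) / (1 - q)"

definition q_fact :: "real \<Rightarrow> nat \<Rightarrow> real" where
  "q_fact q n = (\<Prod>i=1..n. q_bracket q i)"

definition q_exp :: "real \<Rightarrow> complex fps" where
  "q_exp q = Abs_fps (\<lambda>n. 1 / of_real (q_fact q n))"

text \<open>
  The generating function of the \<open>q\<close>-Euler polynomials is a power series in \<open>t\<close> whose
  coefficients are polynomials in \<open>x\<close>. The quotient \<open>2 / (e\<^sub>q(t) + 1)\<close> is formed over the field of
  complex numbers, where \<open>e\<^sub>q(t) + 1\<close> is a unit (its constant coefficient is 2), and then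
  embedded coefficientwise; the second function substitutes \<open>x t\<close> for \<open>t\<close>.
\<close>

definition fps_const_coeffs :: "complex fps \<Rightarrow> complex poly fps" where
  "fps_const_coeffs f = Abs_fps (\<lambda>n. [:fps_nth f n:])"

definition fps_subst_xt :: "complex fps \<Rightarrow> complex poly fps" where
  "fps_subst_xt f = Abs_fps (\<lambda>n. monom (fps_nth f n) n)"

definition q_euler_gf :: "real \<Rightarrow> complex poly fps" where
  "q_euler_gf q = fps_const_coeffs (2 / (q_exp q + 1)) * fps_subst_xt (q_exp q)"

definition q_euler :: "real \<Rightarrow> nat \<Rightarrow> complex poly" where
  "q_euler q n = smult (of_real (q_fact q n)) (fps_nth (q_euler_gf q) n)"

definition q_deriv :: "real \<Rightarrow> (complex \<Rightarrow> complex) \<Rightarrow> complex \<Rightarrow> complex" where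
  "q_deriv q f x =
     (if x = 0 then deriv f 0
      else (f x - f (of_real q * x)) / ((1 - of_real q) * x))"

text \<open>
  For \<open>f(t) = \<Sum>\<^sub>k a\<^sub>k t\<^sup>k / [k]\<^sub>q!\<close>, the number \<open>a\<^sub>k\<close> is \<open>[k]\<^sub>q!\<close> times the \<open>k\<close>-th coefficient of \<open>f\<close>.
\<close>

definition q_functional :: "real \<Rightarrow> complex fps \<Rightarrow> complex poly \<Rightarrow> complex" where
  "q_functional q f p =
     (\<Sum>k\<le>degree p. coeff p k * (of_real (q_fact q k) * fps_nth f k))"

end

theory Submission
  imports Defs
begin

text \<open>
  With \<open>g(t) = 2 / (e\<^sub>q(t) + 1)\<close>, the \<open>x\<^sup>i\<close>-coefficient of \<open>E\<^sub>n\<close> is \<open>[n]\<^sub>q! g\<^sub>n\<^sub>-\<^sub>i / [i]\<^sub>q!\<close>, so a functional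
  \<open>f\<close> takes on \<open>E\<^sub>n\<close> the value \<open>[n]\<^sub>q!\<close> times the \<open>n\<close>-th coefficient of \<open>g f\<close>. For
  \<open>f = (e\<^sub>q(t) + 1) t\<^sup>k\<close> the product is \<open>2 t\<^sup>k\<close>, which makes these functionals biorthogonal to the
  \<open>q\<close>-Euler polynomials. Multiplication by \<open>t\<close> is adjoint to the \<open>q\<close>-derivative, and \<open>e\<^sub>q(t)\<close> and \<open>1\<close>
  act as evaluation at \<open>1\<close> and \<open>0\<close>.
\<close>

lemma q_bracket_nonzero:
  assumes "0 < q" "q < 1" "0 < n"
  shows "q_bracket q n \<noteq> 0"
  using power_Suc_less_one[of q "n - 1"] assms by (simp add: q_bracket_def)

lemma q_fact_nonzero:
  assumes "0 < q" "q < 1"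
  shows "q_fact q n \<noteq> 0"
  using q_bracket_nonzero[OF assms] by (auto simp: q_fact_def)

lemma q_fact_0 [simp]: "q_fact q 0 = 1"
  by (simp add: q_fact_def)

lemma q_fact_Suc: "q_fact q (Suc n) = q_bracket q (Suc n) * q_fact q n"
  by (simp add: q_fact_def)

text \<open>Coefficients beyond the degree vanish. A free upper bound \<open>N\<close> lets
  polynomials of different degrees share one summation range.\<close>

lemma q_functional_altdef:
  assumes "degree p \<le> N"
  shows "q_functional q f p = (\<Sum>k\<le>N. coeff p k * (of_real (q_fact q k) * fps_nth f k))"
  unfolding q_functional_def
  by (rule sum.mono_neutral_left) (use assms in \<open>auto simp: coeff_eq_0\<close>)

lemma q_functional_add_fps:
  "q_functional q (f + g) p = q_functional q f p + q_functional q g p"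
  by (simp add: q_functional_def algebra_simps sum.distrib)

lemma q_functional_sum_smult:
  assumes "finite A"
  shows "q_functional q f (\<Sum>i\<in>A. smult (c i) (p i)) = (\<Sum>i\<in>A. c i * q_functional q f (p i))"
proof -
  obtain N where N: "\<And>i. i \<in> A \<Longrightarrow> degree (p i) \<le> N"
    using finite_nat_set_iff_bounded_le[of "(\<lambda>i. degree (p i)) ` A"] assms by auto
  have "degree (\<Sum>i\<in>A. smult (c i) (p i)) \<le> N"
    using N by (intro degree_sum_le assms) (auto intro: order.trans[OF degree_smult_le])
  then have "q_functional q f (\<Sum>i\<in>A. smult (c i) (p i)) =
      (\<Sum>k\<le>N. \<Sum>i\<in>A. c i * coeff (p i) k * (of_real (q_fact q k) * fps_nth f k))"
    by (simp add: q_functional_altdef coeff_sum sum_distrib_right)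
  also have "\<dots> = (\<Sum>i\<in>A. c i * (\<Sum>k\<le>N. coeff (p i) k * (of_real (q_fact q k) * fps_nth f k)))"
    by (subst sum.swap) (simp add: sum_distrib_left mult.assoc)
  also have "\<dots> = (\<Sum>i\<in>A. c i * q_functional q f (p i))"
    by (intro sum.cong refl) (simp add: q_functional_altdef[OF N])
  finally show ?thesis .
qed

lemma coeff_q_euler:
  "coeff (q_euler q n) i =
     (if i \<le> n then of_real (q_fact q n) * fps_nth (2 / (q_exp q + 1)) (n - i) / of_real (q_fact q i)
      else 0)"
proof -
  define g where "g = 2 / (q_exp q + 1)"
  \<comment> \<open>The \<open>j\<close>-th Cauchy term is the monomial
    \<open>fps_nth g j / of_real (q_fact q (n - j))\<close> times \<open>x^(n - j)\<close>, so only
    \<open>n - j = i\<close> contributes to this coefficient.\<close>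
  have "coeff (fps_nth (q_euler_gf q) n) i =
      (\<Sum>j=0..n. if n - j = i then fps_nth g j / of_real (q_fact q i) else 0)"
    by (auto simp: q_euler_gf_def g_def fps_mult_nth fps_const_coeffs_def fps_subst_xt_def
        q_exp_def coeff_sum intro!: sum.cong)
  also have "\<dots> = (\<Sum>j=0..n. if i \<le> n \<and> j = n - i then fps_nth g j / of_real (q_fact q i) else 0)"
    by (intro sum.cong) auto
  also have "\<dots> = (if i \<le> n then fps_nth g (n - i) / of_real (q_fact q i) else 0)"
    by simp
  finally show ?thesis
    by (simp add: q_euler_def g_def)
qed

lemma q_functional_q_euler:
  assumes "0 < q" "q < 1"
  shows "q_functional q f (q_euler q n) =
    of_real (q_fact q n) * fps_nth (2 / (q_exp q + 1) * f) n"
proof -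
  have "degree (q_euler q n) \<le> n"
    by (intro degree_le) (simp add: coeff_q_euler)
  \<comment> \<open>The weight \<open>q_fact q i\<close> of the functional cancels the denominator
    in \<open>coeff_q_euler\<close>, leaving a plain Cauchy product.\<close>
  then have "q_functional q f (q_euler q n) =
      (\<Sum>i\<le>n. of_real (q_fact q n) * (fps_nth f i * fps_nth (2 / (q_exp q + 1)) (n - i)))"
    using q_fact_nonzero[OF assms]
    by (simp add: q_functional_altdef coeff_q_euler mult_ac)
  also have "\<dots> = of_real (q_fact q n) * fps_nth (f * (2 / (q_exp q + 1))) n"
    by (simp add: fps_mult_nth sum_distrib_left atLeast0AtMost)
  finally show ?thesis
    by (simp only: mult.commute)
qed

lemma q_functional_q_euler_biorthogonal:
  assumes "0 < q" "q < 1"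
  shows "q_functional q ((q_exp q + 1) * fps_X ^ k) (q_euler q n) =
    (if n = k then 2 * of_real (q_fact q k) else 0)"
proof -
  \<comment> \<open>The constant coefficient is 2, so the series is a unit and the division is a
    true inverse.\<close>
  have "fps_nth (q_exp q + 1) 0 \<noteq> 0"
    by (simp add: q_exp_def)
  then have "2 / (q_exp q + 1) * (q_exp q + 1) = 2"
    by (simp add: fps_divide_unit mult.assoc inverse_mult_eq_1)
  then have "2 / (q_exp q + 1) * ((q_exp q + 1) * fps_X ^ k) = fps_const 2 * fps_X ^ k"
    by (metis mult.assoc numeral_fps_const)
  then have "q_functional q ((q_exp q + 1) * fps_X ^ k) (q_euler q n) =
      of_real (q_fact q n) * fps_nth (fps_const 2 * fps_X ^ k) n"
    by (simp only: q_functional_q_euler[OF assms])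
  then show ?thesis
    by simp
qed

text \<open>\<open>q_deriv\<close> acts on functions, while the functional takes polynomials; this
  is the q-derivative at the level of coefficients.\<close>

definition q_pderiv :: "real \<Rightarrow> complex poly \<Rightarrow> complex poly" where
  "q_pderiv q p = (\<Sum>i\<le>degree p. monom (of_real (q_bracket q (Suc i)) * coeff p (Suc i)) i)"

lemma coeff_q_pderiv:
  "coeff (q_pderiv q p) i = of_real (q_bracket q (Suc i)) * coeff p (Suc i)"
  by (auto simp: q_pderiv_def coeff_sum coeff_eq_0)

lemma degree_q_pderiv_le: "degree (q_pderiv q p) \<le> degree p"
  by (intro degree_le) (simp add: coeff_q_pderiv coeff_eq_0)

lemma q_functional_times_X:
  "q_functional q (f * fps_X) p = q_functional q f (q_pderiv q p)"
proof -
  \<comment> \<open>With the bound raised by one, dropping the \<open>k = 0\<close> term, which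
    vanishes because \<open>f * fps_X\<close> has no constant term, leaves the range up to
    \<open>degree p\<close>. The factor \<open>q_bracket q (Suc k)\<close> split off the factorial
    is the one in \<open>coeff_q_pderiv\<close>.\<close>
  have "q_functional q (f * fps_X) p =
      (\<Sum>k\<le>Suc (degree p). coeff p k * (of_real (q_fact q k) * fps_nth (f * fps_X) k))"
    by (rule q_functional_altdef) simp
  also have "\<dots> = (\<Sum>k\<le>degree p. coeff (q_pderiv q p) k * (of_real (q_fact q k) * fps_nth f k))"
    by (subst sum.atMost_Suc_shift) (simp add: coeff_q_pderiv q_fact_Suc mult_ac)
  also have "\<dots> = q_functional q f (q_pderiv q p)"
    by (rule q_functional_altdef[OF degree_q_pderiv_le, symmetric])
  finally show ?thesis .
qed

lemma q_functional_times_X_power: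
  "q_functional q (f * fps_X ^ k) p = q_functional q f ((q_pderiv q ^^ k) p)"
proof (induction k arbitrary: p)
  case (Suc k)
  have "q_functional q (f * fps_X ^ Suc k) p = q_functional q (f * fps_X ^ k * fps_X) p"
    by (simp add: mult_ac)
  also have "\<dots> = q_functional q f ((q_pderiv q ^^ Suc k) p)"
    by (simp only: q_functional_times_X Suc.IH funpow_Suc_right o_apply)
  finally show ?case .
qed simp

lemma q_functional_one: "q_functional q 1 p = poly p 0"
  by (simp add: q_functional_altdef[OF le_refl] if_distrib poly_0_coeff_0 cong: if_cong)

text \<open>The factorials cancel, so every monomial is sent to 1.\<close>

lemma q_functional_q_exp:
  assumes "0 < q" "q < 1"
  shows "q_functional q (q_exp q) p = poly p 1"
  using q_fact_nonzero[OF assms] by (simp add: q_functional_def q_exp_def poly_altdef)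

lemma q_deriv_poly:
  assumes "q \<noteq> 1"
  shows "q_deriv q (poly p) = poly (q_pderiv q p)"
proof
  fix x :: complex
  show "q_deriv q (poly p) x = poly (q_pderiv q p) x"
  proof (cases "x = 0")
    case True
    \<comment> \<open>At 0 both derivatives reduce to the linear coefficient of \<open>p\<close>,
      since \<open>q_bracket q 1 = 1\<close>.\<close>
    have "deriv (poly p) 0 = poly (pderiv p) 0"
      by (intro DERIV_imp_deriv poly_DERIV)
    with True assms show ?thesis
      by (simp add: q_deriv_def poly_0_coeff_0 coeff_pderiv coeff_q_pderiv q_bracket_def)
  next
    case False
    have q1: "1 - complex_of_real q \<noteq> 0"
      using assms by simp
    have expand: "poly r y = (\<Sum>i\<le>N. coeff r i * y ^ i)" if "degree r \<le> N" for r N and y :: complex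
      using that unfolding poly_altdef
      by (intro sum.mono_neutral_left) (auto simp: coeff_eq_0)
    \<comment> \<open>The constant terms cancel, so the sum again runs one index too far and is then
      shifted.\<close>
    have "poly p x - poly p (of_real q * x) =
        (\<Sum>i\<le>Suc (degree p). coeff p i * (x ^ i - (of_real q * x) ^ i))"
      by (simp only: expand[OF le_SucI[OF le_refl]] right_diff_distrib sum_subtractf)
    also have "\<dots> = (\<Sum>i\<le>degree p. coeff p (Suc i) * (x ^ Suc i - (of_real q * x) ^ Suc i))"
      by (subst sum.atMost_Suc_shift) simp
    also have "\<dots> = (\<Sum>i\<le>degree p. coeff (q_pderiv q p) i * x ^ i * ((1 - of_real q) * x))"
    proof (intro sum.cong refl)
      fix i
      have bracket: "(of_real (q_bracket q (Suc i)) :: complex) * (1 - of_real q) = 1 - of_real q ^ Suc i"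
        using q1 by (simp add: q_bracket_def)
      have "coeff p (Suc i) * (x ^ Suc i - (of_real q * x) ^ Suc i) =
          coeff p (Suc i) * x ^ Suc i * (1 - of_real q ^ Suc i)"
        by (simp add: power_mult_distrib right_diff_distrib mult_ac)
      also have "\<dots> = coeff (q_pderiv q p) i * x ^ i * ((1 - of_real q) * x)"
        unfolding bracket[symmetric] by (simp add: coeff_q_pderiv mult_ac)
      finally show "coeff p (Suc i) * (x ^ Suc i - (of_real q * x) ^ Suc i) =
          coeff (q_pderiv q p) i * x ^ i * ((1 - of_real q) * x)" .
    qed
    also have "\<dots> = poly (q_pderiv q p) x * ((1 - of_real q) * x)"
      by (simp only: expand[OF degree_q_pderiv_le] sum_distrib_right)
    finally show ?thesis
      using False q1 by (simp add: q_deriv_def)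
  qed
qed

lemma funpow_q_deriv_poly:
  assumes "q \<noteq> 1"
  shows "(q_deriv q ^^ k) (poly p) = poly ((q_pderiv q ^^ k) p)"
  by (induction k) (simp_all add: q_deriv_poly[OF assms])

theorem theorem3:
  fixes q :: real and n :: nat and p :: "complex poly" and b :: "nat \<Rightarrow> complex"
  assumes "0 < q" and "q < 1"
    and "degree p \<le> n"
    and "p = (\<Sum>k=0..n. smult (b k) (q_euler q k))"
  shows "\<forall>k\<le>n.
     b k = 1 / (2 * of_real (q_fact q k)) * q_functional q ((q_exp q + 1) * fps_X ^ k) p \<and>
     1 / (2 * of_real (q_fact q k)) * q_functional q ((q_exp q + 1) * fps_X ^ k) p =
       1 / (2 * of_real (q_fact q k)) *
         (((q_deriv q ^^ k) (poly p)) 1 + ((q_deriv q ^^ k) (poly p)) 0)"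
proof (intro allI impI)
  fix k assume "k \<le> n"
  let ?F = "of_real (q_fact q k) :: complex"
  let ?L = "q_functional q ((q_exp q + 1) * fps_X ^ k)"
  have "?L p = (\<Sum>j=0..n. b j * ?L (q_euler q j))"
    unfolding assms(4) by (rule q_functional_sum_smult) simp
  \<comment> \<open>Biorthogonality leaves only \<open>j = k\<close>, which lies in the range
    because \<open>k \<le> n\<close>.\<close>
  also have "\<dots> = b k * (2 * ?F)"
    using \<open>k \<le> n\<close>
    by (simp add: q_functional_q_euler_biorthogonal[OF assms(1,2)] if_distrib cong: if_cong)
  finally have coefficient: "?L p = b k * (2 * ?F)" .
  \<comment> \<open>The power of \<open>fps_X\<close> moves onto \<open>p\<close> as q-derivatives;
    the two summands of \<open>q_exp q + 1\<close> then evaluate at 1 and 0.\<close>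
  have "?L p = poly ((q_pderiv q ^^ k) p) 1 + poly ((q_pderiv q ^^ k) p) 0"
    by (simp only: q_functional_times_X_power q_functional_add_fps
        q_functional_q_exp[OF assms(1,2)] q_functional_one)
  then have derivatives: "?L p = (q_deriv q ^^ k) (poly p) 1 + (q_deriv q ^^ k) (poly p) 0"
    using assms(2) by (simp add: funpow_q_deriv_poly)
  show "b k = 1 / (2 * ?F) * ?L p \<and>
      1 / (2 * ?F) * ?L p =
        1 / (2 * ?F) * ((q_deriv q ^^ k) (poly p) 1 + (q_deriv q ^^ k) (poly p) 0)"
    using coefficient derivatives q_fact_nonzero[OF assms(1,2), of k] by simp
qed

end
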